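(* Let $1 \leq p < q$ be relatively prime integers, $\theta = p/q$, and $a_j = 2\cos(2\pi j\theta)$ for $1\le j\le q$. Then for every integer $k$ with $1 \leq k < q/2$, $$\sum_{I\in \widetilde{S}[q,k]} a_I = 0 .$$
   Context: For integers $n\ge 1$ and $0\le k\le n/2$, $\widetilde{S}[n,k]$ denotes the collection of all subsets $I\subset\{1,2,\dots,n\}$ with $|I|=n-2k$ such that $I$ is obtained from $\{1,2,\dots,n\}$ by deleting $k$ pairwise disjoint pairs of adjacent elements, where the adjacent pairs are $\{i,i+1\}$ for $1\le i\le n-1$ together with $\{n,1\}$ (cyclic adjacency). It is a set of subsets: each $I$ is counted once. For $I\subset\{1,\dots,n\}$, $a_I=\prod_{i\in I}a_i$, with $a_\emptyset=1$. *)

theory Defs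
  imports Complex_Main
begin

definition cyclic_adjacent_pairs :: "nat \<Rightarrow> nat set set" where
  "cyclic_adjacent_pairs n = {{i, i + 1} | i. 1 \<le> i \<and> i < n} \<union> {{n, 1}}"

(* The cardinality condition |I| = n - 2k is written additively to avoid truncated subtraction;
   it also excludes the degenerate "pair" {1, 1} for n = 1. The result is a set of subsets I,
   so an I that arises from several choices of P occurs only once. *)
definition S_tilde :: "nat \<Rightarrow> nat \<Rightarrow> nat set set" where
  "S_tilde n k =
     {I. I \<subseteq> {1..n} \<and> card I + 2 * k = n \<and>
         (\<exists>P. P \<subseteq> cyclic_adjacent_pairs n \<and> card P = k \<and> pairwise disjnt P \<and>
              I = {1..n} - \<Union>P)}"

end

theory Submission
  imports Defs
begin

text \<open>
  Write \<open>a j = 2 cos (x + j \<delta>)\<close> and \<open>s j = sin (j \<delta>)\<close>. The idea is that the corresponding sum over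
  a path, instead of a cycle, is a product. For vertices \<open>m, \<dots>, m + N - 1\<close>, let \<open>E m N k\<close> be the sum
  of the products \<open>a\<^sub>I\<close> over all \<open>I\<close> left after deleting \<open>k \<le> N / 2\<close> disjoint pairs of neighbours. Then

  \<open>E m N k = (s (N-k) \<cdots> s (N-2k+1)) / (s 1 \<cdots> s k) * (a (m+k) \<cdots> a (m+N-k-1))\<close>,

  a Gaussian binomial coefficient \<open>[N-k choose k]\<close> in trigonometric form, times the product of \<open>a\<close> over
  the path with \<open>k\<close> vertices cut off at each end. The inner factors are to be expected: if
  \<open>a j = 0\<close>, then \<open>j\<close> must be deleted, and for inner \<open>j\<close> the total contributions of its two pairs
  cancel. The formula is proved, with the denominator multiplied out, by induction
  (\<open>path_sum_closed_form\<close>): distinguishing whether the last vertex is deleted gives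
  \<open>E m N k = a (m+N-1) * E m (N-1) k + E m (N-2) (k-1)\<close> (\<open>path_sum_step\<close>), and the closed form satisfies
  this because of the addition theorem \<open>sin_cos_three_term\<close>.

  On the cycle \<open>1, \<dots>, q\<close>, a deletion that does not use the pair \<open>{q, 1}\<close> is one of the path
  \<open>1, \<dots>, q\<close>, and one that uses it is a deletion of \<open>k - 1\<close> pairs from the path \<open>2, \<dots>, q - 1\<close>
  (\<open>S_tilde_eq\<close>). Since \<open>2 k < q\<close>, no set \<open>I\<close> arises in both ways (\<open>path_deletions_disjoint\<close>), so the
  sum is \<open>E 1 q k + E 2 (q-2) (k-1)\<close>. Both summands contain the same product
  \<open>a (k+1) \<cdots> a (q-k)\<close>, and adding them leaves the factor \<open>s (q-k) + s k\<close>. With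
  \<open>\<delta> = 2 \<pi> p / q\<close> we have \<open>s (q-k) = - s k\<close>, so the sum vanishes; the denominators
  \<open>s 1, \<dots>, s k\<close> are nonzero because \<open>p\<close> and \<open>q\<close> are coprime and \<open>2 k < q\<close>.
\<close>

section \<open>Deleting disjoint pairs of neighbours from a path\<close>

definition path_pairs :: "nat \<Rightarrow> nat \<Rightarrow> nat set set" where
  "path_pairs m n = {{i, i + 1} | i. m \<le> i \<and> i + 1 < n}"

definition path_deletions :: "nat \<Rightarrow> nat \<Rightarrow> nat \<Rightarrow> nat set set" where
  "path_deletions m n k =
     {{m..<n} - \<Union>P | P. P \<subseteq> path_pairs m n \<and> card P = k \<and> pairwise disjnt P}"

lemma path_deletionsI:
  assumes "P \<subseteq> path_pairs m n" "card P = k" "pairwise disjnt P" "I = {m..<n} - \<Union>P"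
  shows "I \<in> path_deletions m n k"
  using assms unfolding path_deletions_def by blast

lemma path_deletionsE:
  assumes "I \<in> path_deletions m n k"
  obtains P where "P \<subseteq> path_pairs m n" "card P = k" "pairwise disjnt P" "I = {m..<n} - \<Union>P"
  using assms unfolding path_deletions_def by blast

lemma path_pairs_subset: "e \<in> path_pairs m n \<Longrightarrow> e \<subseteq> {m..<n}"
  by (auto simp: path_pairs_def)

lemma path_pairs_mono: "m' \<le> m \<Longrightarrow> n \<le> n' \<Longrightarrow> path_pairs m n \<subseteq> path_pairs m' n'"
  by (auto simp: path_pairs_def)

lemma finite_path_pairs: "finite (path_pairs m n)"
  by (rule finite_subset[of _ "Pow {m..<n}"]) (use path_pairs_subset in blast, simp)

lemma path_deletions_subset: "I \<in> path_deletions m n k \<Longrightarrow> I \<subseteq> {m..<n}"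
  by (auto simp: path_deletions_def)

lemma finite_path_deletions: "finite (path_deletions m n k)"
  by (rule finite_subset[of _ "Pow {m..<n}"]) (use path_deletions_subset in blast, simp)

lemma card_Union_pairs:
  assumes "P \<subseteq> path_pairs m n" "pairwise disjnt P"
  shows "card (\<Union>P) = 2 * card P"
proof -
  have "card (\<Union>P) = sum card P"
    by (rule card_Union_disjoint) (use assms in \<open>auto simp: path_pairs_def\<close>)
  also have "\<dots> = (\<Sum>e\<in>P. 2)"
    by (rule sum.cong) (use assms(1) in \<open>auto simp: path_pairs_def\<close>)
  finally show ?thesis by simp
qed

lemma path_deletions_empty:
  assumes "n - m < 2 * k"
  shows "path_deletions m n k = {}"
proof (rule equals0I)
  fix I assume "I \<in> path_deletions m n k"
  then obtain P where P: "P \<subseteq> path_pairs m n" "card P = k" "pairwise disjnt P"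
    by (rule path_deletionsE)
  have "card (\<Union>P) \<le> card {m..<n}"
    by (rule card_mono) (use P(1) path_pairs_subset in blast)+
  with card_Union_pairs[OF P(1,3)] P(2) assms show False by simp
qed

lemma path_deletions_0: "path_deletions m n 0 = {{m..<n}}"
proof -
  have "P \<subseteq> path_pairs m n \<and> card P = 0 \<and> pairwise disjnt P \<longleftrightarrow> P = {}" for P
    using finite_subset[OF _ finite_path_pairs] by auto
  then show ?thesis by (simp add: path_deletions_def)
qed

text \<open>
  Whether the last vertex \<open>n + 1\<close> belongs to \<open>I\<close> decides the case, as the only pair that can delete it
  is \<open>{n, n + 1}\<close>. The two families on the right are therefore disjoint, so the recursion counts each
  set \<open>I\<close> once although it is obtained by choosing pairs.
\<close>

lemma path_deletions_step:
  assumes "m \<le> n"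
  shows "path_deletions m (n + 2) (Suc k)
       = insert (n + 1) ` path_deletions m (n + 1) (Suc k) \<union> path_deletions m n k"
proof (intro equalityI subsetI)
  fix I assume "I \<in> path_deletions m (n + 2) (Suc k)"
  then obtain P where P: "P \<subseteq> path_pairs m (n + 2)" "card P = Suc k" "pairwise disjnt P"
    and I: "I = {m..<n + 2} - \<Union>P" by (rule path_deletionsE)
  show "I \<in> insert (n + 1) ` path_deletions m (n + 1) (Suc k) \<union> path_deletions m n k"
  proof (cases "{n, n + 1} \<in> P")
    case True
    have disj: "e \<inter> {n, n + 1} = {}" if "e \<in> P - {{n, n + 1}}" for e
      using that True P(3) by (auto simp: pairwise_def disjnt_def)
    have sub: "P - {{n, n + 1}} \<subseteq> path_pairs m n"
    proof
      fix e assume e: "e \<in> P - {{n, n + 1}}"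
      then obtain i where "e = {i, i + 1}" "m \<le> i" "i + 1 < n + 2"
        using P(1) by (auto simp: path_pairs_def)
      with disj[OF e] show "e \<in> path_pairs m n"
        by (auto simp: path_pairs_def)
    qed
    have "I = {m..<n} - \<Union>(P - {{n, n + 1}})"
    proof -
      have "\<Union>P = {n, n + 1} \<union> \<Union>(P - {{n, n + 1}})" using True by blast
      then have "I = ({m..<n + 2} - {n, n + 1}) - \<Union>(P - {{n, n + 1}})" using I by blast
      also have "{m..<n + 2} - {n, n + 1} = {m..<n}" by auto
      finally show ?thesis .
    qed
    moreover have "card (P - {{n, n + 1}}) = k"
      using True P(2) by (simp add: card_Diff_singleton_if)
    moreover have "pairwise disjnt (P - {{n, n + 1}})"
      using P(3) by (rule pairwise_subset) blast
    ultimately have "I \<in> path_deletions m n k" using sub by (intro path_deletionsI)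
    then show ?thesis ..
  next
    case False
    have sub: "P \<subseteq> path_pairs m (n + 1)"
    proof
      fix e assume e: "e \<in> P"
      then obtain i where "e = {i, i + 1}" "m \<le> i" "i + 1 < n + 2"
        using P(1) by (auto simp: path_pairs_def)
      moreover from this e False have "i \<noteq> n" by auto
      ultimately show "e \<in> path_pairs m (n + 1)" by (auto simp: path_pairs_def)
    qed
    then have "n + 1 \<notin> \<Union>P" using path_pairs_subset by fastforce
    then have "I = insert (n + 1) ({m..<n + 1} - \<Union>P)" using I assms by auto
    then show ?thesis using sub P(2,3) by (blast intro: path_deletionsI)
  qed
next
  fix I assume "I \<in> insert (n + 1) ` path_deletions m (n + 1) (Suc k) \<union> path_deletions m n k"
  then show "I \<in> path_deletions m (n + 2) (Suc k)"
  proof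
    assume "I \<in> insert (n + 1) ` path_deletions m (n + 1) (Suc k)"
    then obtain P where P: "P \<subseteq> path_pairs m (n + 1)" "card P = Suc k" "pairwise disjnt P"
      and I: "I = insert (n + 1) ({m..<n + 1} - \<Union>P)" by (auto elim: path_deletionsE)
    have "n + 1 \<notin> \<Union>P" using P(1) path_pairs_subset by fastforce
    then have "I = {m..<n + 2} - \<Union>P" using I assms by auto
    moreover have "P \<subseteq> path_pairs m (n + 2)"
      using P(1) path_pairs_mono[of m m "n + 1" "n + 2"] by auto
    ultimately show ?thesis using P(2,3) by (intro path_deletionsI)
  next
    assume "I \<in> path_deletions m n k"
    then obtain P where P: "P \<subseteq> path_pairs m n" "card P = k" "pairwise disjnt P"
      and I: "I = {m..<n} - \<Union>P" by (rule path_deletionsE)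
    have disj: "e \<inter> {n, n + 1} = {}" if "e \<in> P" for e
      using that P(1) path_pairs_subset by fastforce
    show ?thesis
    proof (rule path_deletionsI[of "insert {n, n + 1} P"])
      show "insert {n, n + 1} P \<subseteq> path_pairs m (n + 2)"
        using P(1) assms by (fastforce simp: path_pairs_def)
      have "{n, n + 1} \<notin> P" using disj by blast
      then show "card (insert {n, n + 1} P) = Suc k"
        using P(2) finite_subset[OF P(1) finite_path_pairs] by simp
      show "pairwise disjnt (insert {n, n + 1} P)"
        using P(3) disj by (auto simp: pairwise_insert disjnt_def)
      have "{m..<n} = {m..<n + 2} - {n, n + 1}" by auto
      then show "I = {m..<n + 2} - \<Union>(insert {n, n + 1} P)" using I by blast
    qed
  qed
qed

section \<open>The path sum for a cosine sequence is a product\<close>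

definition path_sum :: "(nat \<Rightarrow> real) \<Rightarrow> nat \<Rightarrow> nat \<Rightarrow> nat \<Rightarrow> real" where
  "path_sum a m n k = (\<Sum>I\<in>path_deletions m n k. \<Prod>i\<in>I. a i)"

lemma path_sum_0: "path_sum a m n 0 = (\<Prod>i=m..<n. a i)"
  by (simp add: path_sum_def path_deletions_0)

lemma path_sum_eq_0: "n - m < 2 * k \<Longrightarrow> path_sum a m n k = 0"
  by (simp add: path_sum_def path_deletions_empty)

lemma path_sum_step:
  assumes "m \<le> n"
  shows "path_sum a m (n + 2) (Suc k) = a (n + 1) * path_sum a m (n + 1) (Suc k) + path_sum a m n k"
proof -
  have notin: "n + 1 \<notin> I" if "I \<in> path_deletions m (n + 1) (Suc k) \<union> path_deletions m n k" for I
    using that path_deletions_subset by fastforce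
  have inj: "inj_on (insert (n + 1)) (path_deletions m (n + 1) (Suc k))"
  proof (rule inj_onI)
    fix I J assume "I \<in> path_deletions m (n + 1) (Suc k)" "J \<in> path_deletions m (n + 1) (Suc k)"
      and "insert (n + 1) I = insert (n + 1) J"
    then show "I = J" using notin[of I] notin[of J] insert_ident[of "n + 1" I J] by blast
  qed
  have "path_sum a m (n + 2) (Suc k)
      = (\<Sum>I\<in>insert (n + 1) ` path_deletions m (n + 1) (Suc k). \<Prod>i\<in>I. a i) + path_sum a m n k"
    unfolding path_sum_def path_deletions_step[OF assms]
    by (rule sum.union_disjoint) (use notin in \<open>auto simp: finite_path_deletions\<close>)
  also have "(\<Sum>I\<in>insert (n + 1) ` path_deletions m (n + 1) (Suc k). \<Prod>i\<in>I. a i)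
           = (\<Sum>I\<in>path_deletions m (n + 1) (Suc k). a (n + 1) * (\<Prod>i\<in>I. a i))"
    unfolding sum.reindex[OF inj] o_def
  proof (rule sum.cong)
    fix I assume I: "I \<in> path_deletions m (n + 1) (Suc k)"
    have "finite I" using path_deletions_subset[OF I] finite_subset by blast
    then show "(\<Prod>i\<in>insert (n + 1) I. a i) = a (n + 1) * (\<Prod>i\<in>I. a i)"
      using notin[of I] I by (intro prod.insert) auto
  qed simp
  finally show ?thesis by (simp add: path_sum_def sum_distrib_left)
qed

text \<open>
  By the product-to-sum formula each term is a difference of two sines, and those on the left
  telescope. After cancelling common factors, this is the recursion \<open>path_sum_step\<close> for the
  closed form below.
\<close>

lemma sin_cos_three_term:
  fixes x \<delta> :: real and r k j :: nat
  defines "a \<equiv> \<lambda>j::nat. 2 * cos (x + real j * \<delta>)"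
  shows "sin (real r * \<delta>) * a (j + k + r) + sin (real k * \<delta>) * a j
       = sin (real (r + k) * \<delta>) * a (j + r)"
proof -
  have product_to_sum: "sin \<alpha> * (2 * cos \<beta>) = sin (\<beta> + \<alpha>) - sin (\<beta> - \<alpha>)" for \<alpha> \<beta> :: real
    by (simp add: sin_add sin_diff)
  show ?thesis
    unfolding a_def product_to_sum by (simp add: algebra_simps)
qed

text \<open>
  The path has \<open>2 k + r\<close> vertices, so \<open>r\<close> is the number of vertices that survive. With
  this parametrization the two path sums in the recursion belong to \<open>(k + 1, r)\<close> and \<open>(k, r + 1)\<close>,
  which suits an induction on \<open>k\<close> and then on \<open>r\<close>. Multiplying out the denominator of the trigonometric
  binomial coefficient keeps the identity valid also where some \<open>sin (i \<delta>)\<close> is zero.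
\<close>

lemma path_sum_closed_form:
  fixes x \<delta> :: real
  defines "a \<equiv> \<lambda>j::nat. 2 * cos (x + real j * \<delta>)"
  shows "(\<Prod>i=1..k. sin (real i * \<delta>)) * path_sum a m (m + 2 * k + r) k
       = (\<Prod>i=1..k. sin (real (r + i) * \<delta>)) * (\<Prod>i=m + k..<m + k + r. a i)"
proof (induction k arbitrary: r)
  case 0
  show ?case by (simp add: path_sum_0)
next
  case (Suc k)
  note outer = Suc.IH
  show ?case
  proof (induction r)
    case 0
    have "path_sum a m (m + 2 * Suc k + 0) (Suc k) = path_sum a m (m + 2 * k + 0) k"
      using path_sum_step[of m "m + 2 * k" a k] by (simp add: path_sum_eq_0)
    then have "(\<Prod>i=1..Suc k. sin (real i * \<delta>)) * path_sum a m (m + 2 * Suc k + 0) (Suc k)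
        = sin (real (Suc k) * \<delta>)
          * ((\<Prod>i=1..k. sin (real i * \<delta>)) * path_sum a m (m + 2 * k + 0) k)"
      by (simp only: prod.cl_ivl_Suc) (simp add: ac_simps)
    also have "\<dots> = sin (real (Suc k) * \<delta>) * (\<Prod>i=1..k. sin (real i * \<delta>))"
      unfolding outer by simp
    finally show ?case by (simp add: mult.commute)
  next
    case (Suc r)
    define s where "s j = sin (real j * \<delta>)" for j :: nat
    define F where "F = (\<Prod>i=1..k. s i)"
    define G where "G = (\<Prod>i=1..k. s (Suc r + i))"
    define A where "A = (\<Prod>i=m + Suc k..<m + Suc k + r. a i)"
    define N where "N = m + 2 * k + Suc r"
    have F_Suc: "(\<Prod>i=1..Suc k. s i) = s (Suc k) * F"
      by (simp add: F_def)
    \<comment> \<open>The numerators of the closed form for \<open>(k + 1, r)\<close>, \<open>(k, r + 1)\<close> and \<open>(k + 1, r + 1)\<close> are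
      products of consecutive sines that share the factor \<open>G\<close>; similarly \<open>A\<close> for the cosines.\<close>
    have G_left: "(\<Prod>i=1..Suc k. s (r + i)) = s (Suc r) * G"
      unfolding G_def by (induction k) (simp_all add: ac_simps)
    have G_right: "(\<Prod>i=1..Suc k. s (Suc r + i)) = G * s (Suc r + Suc k)"
      by (simp add: G_def)
    have A_left: "(\<Prod>i=m + k..<m + k + Suc r. a i) = a (m + k) * A"
      unfolding A_def by (subst prod.atLeast_Suc_lessThan) simp_all
    have A_right: "(\<Prod>i=m + Suc k..<m + Suc k + Suc r. a i) = A * a (m + Suc k + r)"
      by (simp add: A_def)
    have "m \<le> N"
      by (simp add: N_def)
    have N: "m + 2 * Suc k + r = N + 1" "m + 2 * Suc k + Suc r = N + 2"
      by (simp_all add: N_def)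
    have IH1: "s (Suc k) * F * path_sum a m (N + 1) (Suc k) = s (Suc r) * G * A"
      using Suc.IH unfolding s_def[symmetric] F_Suc G_left A_def[symmetric] N .
    have IH2: "F * path_sum a m N k = G * (a (m + k) * A)"
      using outer[of "Suc r"]
      unfolding s_def[symmetric] F_def[symmetric] G_def[symmetric] A_left N_def[symmetric] .
    have trig: "s (Suc r) * a (N + 1) + s (Suc k) * a (m + k)
              = s (Suc r + Suc k) * a (m + Suc k + r)"
    proof -
      have "N + 1 = m + k + Suc k + Suc r" and "m + Suc k + r = m + k + Suc r"
        by (simp_all add: N_def)
      then show ?thesis
        unfolding a_def s_def by (simp only: sin_cos_three_term)
    qed
    have "s (Suc k) * F * path_sum a m (N + 2) (Suc k)
        = a (N + 1) * (s (Suc k) * F * path_sum a m (N + 1) (Suc k))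
          + s (Suc k) * (F * path_sum a m N k)"
      using path_sum_step[of m N a k] \<open>m \<le> N\<close> by (simp only: distrib_left mult_ac)
    also have "\<dots> = G * A * (s (Suc r) * a (N + 1) + s (Suc k) * a (m + k))"
      unfolding IH1 IH2 by (simp add: distrib_left mult_ac)
    also have "\<dots> = G * s (Suc r + Suc k) * (A * a (m + Suc k + r))"
      unfolding trig by (simp add: mult_ac)
    finally show ?case
      unfolding s_def[symmetric] F_Suc G_right A_right N .
  qed
qed

section \<open>From the path to the cycle\<close>

text \<open>
  As \<open>i\<close> survives, no deleted pair crosses it, so the vertices before the first survivor are
  partitioned into pairs.
\<close>

lemma even_gap:
  assumes I: "I \<in> path_deletions m n k" and "i \<in> I" and least: "\<And>j. j \<in> I \<Longrightarrow> i \<le> j"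
  shows "even (i - m)"
proof -
  obtain P where P: "P \<subseteq> path_pairs m n" "pairwise disjnt P" and I: "I = {m..<n} - \<Union>P"
    using I by (rule path_deletionsE)
  define Q where "Q = {e \<in> P. e \<subseteq> {m..<i}}"
  have i: "m \<le> i" "i < n" "i \<notin> \<Union>P" using \<open>i \<in> I\<close> I by auto
  have "{m..<i} \<subseteq> \<Union>Q"
  proof
    fix j assume j: "j \<in> {m..<i}"
    then have "j \<notin> I" using least[of j] by auto
    then obtain e where e: "e \<in> P" "j \<in> e" using I j i by auto
    then obtain l where l: "e = {l, l + 1}" "m \<le> l" using P(1) by (auto simp: path_pairs_def)
    have "i \<notin> e" using e(1) i(3) by blast
    then have "e \<subseteq> {m..<i}" using l e(2) j by auto
    then show "j \<in> \<Union>Q" using e unfolding Q_def by blast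
  qed
  then have "\<Union>Q = {m..<i}" unfolding Q_def by blast
  moreover have "card (\<Union>Q) = 2 * card Q"
    by (rule card_Union_pairs[of _ m n]) (use P in \<open>auto simp: Q_def intro: pairwise_subset\<close>)
  ultimately show ?thesis by simp
qed

text \<open>
  The first element of a common set would have both an even distance to \<open>m\<close> and an even distance to
  \<open>m + 1\<close>. The hypothesis ensures that some element survives; without it, the empty set can be
  obtained in both ways, by the two perfect matchings of an even cycle.
\<close>

lemma path_deletions_disjoint:
  assumes "2 * k < n - m"
  shows "path_deletions m n k \<inter> path_deletions (m + 1) n' k' = {}"
proof (rule equals0I)
  fix I assume "I \<in> path_deletions m n k \<inter> path_deletions (m + 1) n' k'"
  then have I: "I \<in> path_deletions m n k" "I \<in> path_deletions (m + 1) n' k'" by auto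
  have "I \<noteq> {}"
  proof
    assume "I = {}"
    with I(1) have "{} \<in> path_deletions m n k" by simp
    then obtain P where P: "P \<subseteq> path_pairs m n" "card P = k" "pairwise disjnt P"
      and cover: "{} = {m..<n} - \<Union>P" by (rule path_deletionsE)
    have "\<Union>P \<subseteq> {m..<n}" using P(1) path_pairs_subset by blast
    with cover have "\<Union>P = {m..<n}" by blast
    with card_Union_pairs[OF P(1,3)] P(2) assms show False by simp
  qed
  then obtain j where "j \<in> I" by blast
  define i where "i = (LEAST i. i \<in> I)"
  have "i \<in> I" unfolding i_def using \<open>j \<in> I\<close> by (rule LeastI)
  moreover have "i \<le> j" if "j \<in> I" for j unfolding i_def using that by (rule Least_le)
  ultimately have i: "i \<in> I" "\<And>j. j \<in> I \<Longrightarrow> i \<le> j" by blast+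
  have "even (i - m)" by (rule even_gap[OF I(1) i])
  moreover have "even (i - (m + 1))" by (rule even_gap[OF I(2) i])
  moreover have "m + 1 \<le> i" using path_deletions_subset[OF I(2)] i(1) by auto
  ultimately show False by presburger
qed

text \<open>
  The two parts correspond to the deletions without and with the pair \<open>{q, 1}\<close>. For \<open>q \<ge> 3\<close> this
  pair has two elements and is not one of the path pairs.
\<close>

lemma S_tilde_eq:
  assumes "3 \<le> q"
  shows "S_tilde q (Suc k) = path_deletions 1 (q + 1) (Suc k) \<union> path_deletions 2 q k"
proof -
  have pairs: "cyclic_adjacent_pairs q = insert {q, 1} (path_pairs 1 (q + 1))"
    by (auto simp: cyclic_adjacent_pairs_def path_pairs_def)
  have ivl: "{1..q} = {1..<q + 1}" by auto
  show ?thesis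
  proof (intro equalityI subsetI)
    fix I assume "I \<in> S_tilde q (Suc k)"
    then obtain P where P: "P \<subseteq> insert {q, 1} (path_pairs 1 (q + 1))" "card P = Suc k"
      "pairwise disjnt P" and I: "I = {1..<q + 1} - \<Union>P"
      unfolding S_tilde_def pairs ivl by blast
    show "I \<in> path_deletions 1 (q + 1) (Suc k) \<union> path_deletions 2 q k"
    proof (cases "{q, 1} \<in> P")
      case True
      have disj: "e \<inter> {q, 1} = {}" if "e \<in> P - {{q, 1}}" for e
        using that True P(3) by (auto simp: pairwise_def disjnt_def)
      have sub: "P - {{q, 1}} \<subseteq> path_pairs 2 q"
      proof
        fix e assume e: "e \<in> P - {{q, 1}}"
        then obtain i where "e = {i, i + 1}" "1 \<le> i" "i + 1 < q + 1"
          using P(1) by (auto simp: path_pairs_def)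
        moreover from this disj[OF e] have "i \<noteq> 1" "i + 1 \<noteq> q" by auto
        ultimately have "2 \<le> i" "i + 1 < q" by auto
        with \<open>e = {i, i + 1}\<close> show "e \<in> path_pairs 2 q" by (auto simp: path_pairs_def)
      qed
      have "\<Union>P = {q, 1} \<union> \<Union>(P - {{q, 1}})" using True by blast
      then have "I = ({1..<q + 1} - {q, 1}) - \<Union>(P - {{q, 1}})" using I by blast
      also have "{1..<q + 1} - {q, 1} = {2..<q}" using assms by auto
      finally have "I = {2..<q} - \<Union>(P - {{q, 1}})" .
      moreover have "card (P - {{q, 1}}) = k"
        using True P(2) by (simp add: card_Diff_singleton_if)
      moreover have "pairwise disjnt (P - {{q, 1}})"
        using P(3) by (rule pairwise_subset) blast
      ultimately have "I \<in> path_deletions 2 q k" using sub by (intro path_deletionsI)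
      then show ?thesis ..
    next
      case False
      then have "P \<subseteq> path_pairs 1 (q + 1)" using P(1) by blast
      then show ?thesis using P(2,3) I by (blast intro: path_deletionsI)
    qed
  next
    have mem: "I \<in> S_tilde q (Suc k)"
      if P: "P \<subseteq> insert {q, 1} (path_pairs 1 (q + 1))" "card P = Suc k"
        "pairwise disjnt P" and I: "I = {1..<q + 1} - \<Union>P" for I P
    proof -
      have "card (\<Union>P) = sum card P"
        by (rule card_Union_disjoint) (use P in \<open>auto simp: path_pairs_def\<close>)
      also have "\<dots> = (\<Sum>e\<in>P. 2)"
        by (rule sum.cong) (use P(1) assms in \<open>auto simp: path_pairs_def\<close>)
      finally have "card (\<Union>P) = 2 * Suc k" using P(2) by simp
      moreover have "\<Union>P \<subseteq> {1..<q + 1}" 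
        using P(1) path_pairs_subset[of _ 1 "q + 1"] assms by fastforce
      moreover have "card (\<Union>P) \<le> card {1..<q + 1}" 
        by (rule card_mono) (use calculation in auto)
      ultimately have "card I + 2 * Suc k = q"
        unfolding I by (subst card_Diff_subset) (auto intro: finite_subset)
      with P I show ?thesis unfolding S_tilde_def pairs ivl by blast
    qed
    fix I assume "I \<in> path_deletions 1 (q + 1) (Suc k) \<union> path_deletions 2 q k"
    then show "I \<in> S_tilde q (Suc k)"
    proof
      assume "I \<in> path_deletions 1 (q + 1) (Suc k)"
      then show ?thesis by (rule path_deletionsE) (blast intro: mem)
    next
      assume "I \<in> path_deletions 2 q k"
      then obtain P where P: "P \<subseteq> path_pairs 2 q" "card P = k" "pairwise disjnt P"
        and I: "I = {2..<q} - \<Union>P" by (rule path_deletionsE)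
      have disj: "e \<inter> {q, 1} = {}" if "e \<in> P" for e
        using that P(1) path_pairs_subset by fastforce
      show ?thesis
      proof (rule mem[of "insert {q, 1} P"])
        show "insert {q, 1} P \<subseteq> insert {q, 1} (path_pairs 1 (q + 1))"
          using P(1) path_pairs_mono[of 1 2 q "q + 1"] by auto
        have "{q, 1} \<notin> P" using disj by blast
        then show "card (insert {q, 1} P) = Suc k"
          using P(2) finite_subset[OF P(1) finite_path_pairs] by simp
        show "pairwise disjnt (insert {q, 1} P)"
          using P(3) disj by (auto simp: pairwise_insert disjnt_def)
        have "{2..<q} = {1..<q + 1} - {q, 1}" using assms by auto
        then show "I = {1..<q + 1} - \<Union>(insert {q, 1} P)" using I by blast
      qed
    qed
  qed
qed

section \<open>Vanishing of the cyclic sum\<close>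

lemma sin_multiple_nonzero:
  fixes p q j :: nat
  assumes "coprime p q" and "0 < j" and "2 * j < q"
  shows "sin (real j * (2 * pi * (real p / real q))) \<noteq> 0"
proof
  assume "sin (real j * (2 * pi * (real p / real q))) = 0"
  then obtain z :: int where "real j * (2 * pi * (real p / real q)) = of_int z * pi"
    by (auto simp: sin_zero_iff_int2)
  then have "real (2 * j * p) = of_int (z * int q)"
    using assms(3) by (simp add: field_simps)
  then have "int (2 * j * p) = z * int q"
    by linarith
  then have "int q dvd int (2 * j * p)" by simp
  then have "q dvd 2 * j * p" by (simp only: int_dvd_int_iff)
  with \<open>coprime p q\<close> have "q dvd 2 * j"
    by (simp add: coprime_commute coprime_dvd_mult_left_iff)
  with assms(2,3) show False by (auto dest: dvd_imp_le)
qed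

theorem theorem2p5:
  fixes p q k :: nat and \<theta> :: real and a :: "nat \<Rightarrow> real"
  assumes "1 \<le> p" and "p < q" and "coprime p q"
    and "\<theta> = real p / real q"
    and "\<And>j. 1 \<le> j \<Longrightarrow> j \<le> q \<Longrightarrow> a j = 2 * cos (2 * pi * real j * \<theta>)"
    and "1 \<le> k" and "real k < real q / 2"
  shows "(\<Sum>I\<in>S_tilde q k. \<Prod>i\<in>I. a i) = 0"
proof -
  define \<delta> where "\<delta> = 2 * pi * \<theta>"
  \<comment> \<open>The closed form holds for every phase \<open>x\<close>; here \<open>x = 0\<close>.\<close>
  define b where "b = (\<lambda>j::nat. 2 * cos (0 + real j * \<delta>))"
  let ?s = "\<lambda>j::nat. sin (real j * \<delta>)"
  have "2 * k < q" using assms(7) by linarith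
  then have "q = 2 * k + (q - 2 * k)" and "0 < q - 2 * k" by auto
  then obtain r where q: "q = 2 * k + r" "0 < r" by blast
  obtain l where k: "k = Suc l" using \<open>1 \<le> k\<close> by (cases k) auto
  have "3 \<le> q" using q k by simp
  let ?A = "\<Prod>i=1 + k..<1 + k + r. b i"
  have "(\<Sum>I\<in>S_tilde q k. \<Prod>i\<in>I. a i) = (\<Sum>I\<in>S_tilde q k. \<Prod>i\<in>I. b i)"
    by (intro sum.cong prod.cong refl)
       (auto simp: S_tilde_def b_def assms(5) \<delta>_def ac_simps)
  also have "\<dots> = path_sum b 1 (1 + 2 * k + r) k + path_sum b 2 (2 + 2 * l + r) l"
  proof -
    have "path_deletions 1 (q + 1) (Suc l) \<inter> path_deletions (1 + 1) q l = {}"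
      by (rule path_deletions_disjoint) (use q k in simp)
    then have split: "(\<Sum>I\<in>S_tilde q k. \<Prod>i\<in>I. b i) = path_sum b 1 (q + 1) k + path_sum b 2 q l"
      unfolding k path_sum_def S_tilde_eq[OF \<open>3 \<le> q\<close>] one_add_one
      by (intro sum.union_disjoint finite_path_deletions)
    have ends: "1 + 2 * k + r = q + 1" "2 + 2 * l + r = q" using q k by simp_all
    show ?thesis unfolding ends by (rule split)
  qed
  finally have sum: "(\<Sum>I\<in>S_tilde q k. \<Prod>i\<in>I. a i) = \<dots>" .
  \<comment> \<open>The denominator for \<open>k\<close> also clears that for \<open>l = k - 1\<close>, leaving the extra factor \<open>sin (k \<delta>)\<close>.\<close>
  have "(\<Prod>i=1..k. ?s i) * (\<Sum>I\<in>S_tilde q k. \<Prod>i\<in>I. a i)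
      = (\<Prod>i=1..k. ?s i) * path_sum b 1 (1 + 2 * k + r) k
        + ?s k * ((\<Prod>i=1..l. ?s i) * path_sum b 2 (2 + 2 * l + r) l)"
    unfolding sum by (simp add: k algebra_simps)
  also have "\<dots> = (\<Prod>i=1..k. ?s (r + i)) * ?A + ?s k * ((\<Prod>i=1..l. ?s (r + i)) * ?A)"
    unfolding b_def path_sum_closed_form by (simp add: k)
  also have "\<dots> = (\<Prod>i=1..l. ?s (r + i)) * ?A * (?s (r + k) + ?s k)"
    by (simp add: k algebra_simps)
  also have "?s (r + k) = - ?s k"
  proof -
    have "real q * \<delta> = 2 * real p * pi"
      using assms(2,4) by (simp add: \<delta>_def)
    moreover have "real (r + k) = real q - real k" using q by simp
    ultimately have "real (r + k) * \<delta> = 2 * real p * pi - real k * \<delta>"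
      by (simp only: left_diff_distrib)
    then show ?thesis
      by (simp only: sin_diff sin_2npi cos_2npi)
  qed
  finally have "(\<Prod>i=1..k. ?s i) * (\<Sum>I\<in>S_tilde q k. \<Prod>i\<in>I. a i) = 0" by simp
  moreover have "(\<Prod>i=1..k. ?s i) \<noteq> 0"
    using sin_multiple_nonzero[OF assms(3)] \<open>2 * k < q\<close> assms(4) by (simp add: \<delta>_def)
  ultimately show ?thesis by simp
qed

end
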